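(* Let $m,k\ge1$ be integers, $n=mk$, $\lambda_e,\lambda_s,\lambda_c>0$ and $\lambda_g\ge0$. Consider a clustered network with $m$ clusterheads, each serving a cluster of $k$ end-nodes, in which the source-to-clusterhead network is disconnected and the end-nodes within each cluster form a fully connected gossip network. Write $(X,Y)$ for the configuration using scheme $X$ at the source-to-clusterhead stage and scheme $Y$ within the clusters. Then the long-term average freshness $\overline{F}_i$ of every end-node $i$ is as follows. 1. For $(DC_{\mathrm{noRC}},FC_{\mathrm{noRC}})$ with $k\ge2$: $$\frac{\lambda_s}{\lambda_s+m\lambda_e}\sum_{r=1}^{k}\left(\prod_{i=1}^{r-1}\frac{(k-i)\left(\frac{\lambda_c}{k}+(i-1)\frac{\lambda_g}{k-1}\right)}{(k-i+1)\left(\frac{\lambda_c}{k}+(i-1)\frac{\lambda_g}{k-1}\right)+\lambda_e}\right)\frac{\frac{\lambda_c}{k}+(r-1)\frac{\lambda_g}{k-1}}{(k-r+1)\left(\frac{\lambda_c}{k}+(r-1)\frac{\lambda_g}{k-1}\right)+\lambda_e}.$$ 2. For $(DC_{\mathrm{RC}},FC_{\mathrm{noRC}})$ with $k\ge2$: $$\frac1m\frac{\lambda_s}{\lambda_e}\left[1-\left(\frac{\lambda_s}{\lambda_s+\lambda_e}\right)^m\right]\sum_{r=1}^{k}\left(\prod_{i=1}^{r-1}\frac{(k-i)\left(\frac{\lambda_c}{k}+(i-1)\frac{\lambda_g}{k-1}\right)}{(k-i+1)\left(\frac{\lambda_c}{k}+(i-1)\frac{\lambda_g}{k-1}\right)+\lambda_e}\right)\frac{\frac{\lambda_c}{k}+(r-1)\frac{\lambda_g}{k-1}}{(k-r+1)\left(\frac{\lambda_c}{k}+(r-1)\frac{\lambda_g}{k-1}\right)+\lambda_e}.$$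 3. For $(DC_{\mathrm{RC}},FC_{\mathrm{allRC}})$: $$\frac1m\frac{\lambda_s}{\lambda_e}\left[1-\left(\frac{\lambda_s}{\lambda_s+\lambda_e}\right)^m\right]\cdot\frac1k\sum_{r=1}^{k}\prod_{i=1}^{r}\frac{\lambda_c+(i-1)\lambda_g}{\lambda_c+(i-1)\lambda_g+\lambda_e}.$$ (In the products, $i$ is a running index, and empty products equal $1$.)
   Context: A source self-updates according to a Poisson process of rate $\lambda_e$. There are $n$ end-nodes divided into $m=n/k$ clusters of size $k$, each with a clusterhead (CH). The source sends updates only to the CHs, with total rate $\lambda_s$; each CH sends updates to its own $k$ end-nodes, with total rate $\lambda_c$. CHs do not communicate with each other. Within each cluster every end-node gossips with the other end-nodes of that cluster with total rate $\lambda_g$; there is no gossip across clusters. A CH or end-node is fresh if it holds the current source version, and stale otherwise. For an end-node, $F_i(t)=1$ if it is fresh at time $t$ and $F_i(t)=0$ otherwise, and $\overline{F}_i=\limsup_{T\to\infty}\frac1T\mathbb{E}\big[\int_0^T F_i(t)\,dt\big]$. The vector of fresh/stale states of all CHs and end-nodes is a continuous-time Markov chain, started with everything stale, with the following transitions. - At rate $\lambda_e$ the source self-updates and all CHs and end-nodes become stale. - Source-to-CH stage: each stale CH becomes fresh at rate $\lambda_s/m$ under $DC_{\mathrm{noRC}}$ (traditional gossip), and at rate $\lambda_s/(m-\ell)$ under $DC_{\mathrm{RC}}$ (rate-changing gossip), where $\ell$ is the current number of fresh CHs. - Within a cluster: no end-node can become fresh while its CH is stale. If the CH is fresh and $\ell'<k$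 end-nodes of the cluster are fresh, then each stale end-node of the cluster becomes fresh at rate $\frac{\lambda_c}{k}+\ell'\frac{\lambda_g}{k-1}$ under $FC_{\mathrm{noRC}}$ (traditional gossip: the CH sends to each node at fixed rate $\lambda_c/k$ and each fresh node sends to each other node at fixed rate $\lambda_g/(k-1)$), and at rate $\frac{\lambda_c+\ell'\lambda_g}{k-\ell'}$ under $FC_{\mathrm{allRC}}$ (rate-changing gossip: the CH and each fresh node split their total rates equally among the currently stale nodes of the cluster). All underlying Poisson clocks are independent. *)

theory Defs
  imports "HOL-Probability.Probability"
begin

definition generator :: "'s set \<Rightarrow> ('s \<Rightarrow> 's \<Rightarrow> real) \<Rightarrow> 's \<Rightarrow> 's \<Rightarrow> real" where
  "generator S r x y = (if x = y then - (\<Sum>z\<in>S - {x}. r x z) else r x y)"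

definition transition_semigroup ::
  "'s set \<Rightarrow> ('s \<Rightarrow> 's \<Rightarrow> real) \<Rightarrow> (real \<Rightarrow> 's \<Rightarrow> 's \<Rightarrow> real) \<Rightarrow> bool" where
  "transition_semigroup S Q P \<longleftrightarrow>
     (\<forall>h\<ge>0. \<forall>x\<in>S. (\<forall>y\<in>S. 0 \<le> P h x y) \<and> (\<Sum>y\<in>S. P h x y) = 1) \<and>
     (\<forall>x\<in>S. \<forall>y\<in>S. P 0 x y = (if x = y then 1 else 0)) \<and>
     (\<forall>g\<ge>0. \<forall>h\<ge>0. \<forall>x\<in>S. \<forall>y\<in>S. P (g + h) x y = (\<Sum>z\<in>S. P g x z * P h z y)) \<and>
     (\<forall>x\<in>S. \<forall>y\<in>S. ((\<lambda>h. P h x y) has_real_derivative Q x y) (at 0 within {0..}))"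

text \<open>
  \<open>ctmc M S r x\<^sub>0 X\<close>: on the probability space \<open>M\<close>, the process \<open>(X t)\<close>, \<open>t \<ge> 0\<close>, is a
  time-homogeneous Markov chain on the finite set \<open>S\<close>, started at \<open>x\<^sub>0\<close>, with right-continuous
  (for the discrete topology) paths and jump rate \<open>r x y\<close> from \<open>x\<close> to each \<open>y \<noteq> x\<close>.
  The values \<open>r x x\<close> and the behaviour of \<open>X\<close> at negative times are irrelevant.
\<close>

definition ctmc ::
  "'a measure \<Rightarrow> 's set \<Rightarrow> ('s \<Rightarrow> 's \<Rightarrow> real) \<Rightarrow> 's \<Rightarrow> (real \<Rightarrow> 'a \<Rightarrow> 's) \<Rightarrow> bool" where
  "ctmc M S r x\<^sub>0 X \<longleftrightarrow>
     prob_space M \<and> finite S \<and>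
     (\<forall>t\<ge>0. X t \<in> measurable M (count_space S)) \<and>
     (\<forall>\<omega>\<in>space M. \<forall>t\<ge>0. \<exists>\<epsilon>>0. \<forall>s\<in>{t..<t + \<epsilon>}. X s \<omega> = X t \<omega>) \<and>
     (AE \<omega> in M. X 0 \<omega> = x\<^sub>0) \<and>
     (\<exists>P. transition_semigroup S (generator S r) P \<and>
        (\<forall>t\<ge>0. \<forall>h\<ge>0. \<forall>x\<in>S. \<forall>y\<in>S. \<forall>I \<sigma>. finite I \<longrightarrow> I \<subseteq> {0..<t} \<longrightarrow>
           \<P>(\<omega> in M. X t \<omega> = x \<and> (\<forall>s\<in>I. X s \<omega> = \<sigma> s)) > 0 \<longrightarrow>
           \<P>(\<omega> in M. X (t + h) \<omega> = y \<bar> X t \<omega> = x \<and> (\<forall>s\<in>I. X s \<omega> = \<sigma> s)) = P h x y))"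

text \<open>
  \<open>CH c\<close> is the clusterhead of cluster \<open>c < m\<close> and \<open>EN c j\<close>, \<open>j < k\<close>, are its end-nodes.
  A state of the network is identified with the set of its fresh nodes.
\<close>

datatype node = CH nat | EN nat nat

definition nodes :: "nat \<Rightarrow> nat \<Rightarrow> node set" where
  "nodes m k = CH ` {..<m} \<union> (\<lambda>(c, j). EN c j) ` ({..<m} \<times> {..<k})"

datatype source_scheme = DC_noRC | DC_RC

datatype cluster_scheme = FC_noRC | FC_allRC

text \<open>
  \<open>ch_rate\<close> and \<open>en_rate\<close> are the rates at which a single stale clusterhead (resp. a single stale
  end-node whose clusterhead is fresh) becomes fresh when \<open>l\<close> clusterheads (resp. \<open>l\<close> end-nodes
  of the same cluster) are fresh.
\<close>

fun ch_rate :: "source_scheme \<Rightarrow> nat \<Rightarrow> real \<Rightarrow> nat \<Rightarrow> real" where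
  "ch_rate DC_noRC m lam_s l = lam_s / real m"
| "ch_rate DC_RC m lam_s l = lam_s / (real m - real l)"

fun en_rate :: "cluster_scheme \<Rightarrow> nat \<Rightarrow> real \<Rightarrow> real \<Rightarrow> nat \<Rightarrow> real" where
  "en_rate FC_noRC k lam_c lam_g l = lam_c / real k + real l * (lam_g / (real k - 1))"
| "en_rate FC_allRC k lam_c lam_g l = (lam_c + real l * lam_g) / (real k - real l)"

context
  fixes src :: source_scheme and cl :: cluster_scheme
    and m k :: nat and lam_e lam_s lam_c lam_g :: real
begin

primrec fresh_rate :: "node set \<Rightarrow> node \<Rightarrow> real" where
  "fresh_rate x (CH c) = ch_rate src m lam_s (card {c'. c' < m \<and> CH c' \<in> x})"
| "fresh_rate x (EN c j) =
     (if CH c \<in> x then en_rate cl k lam_c lam_g (card {j'. j' < k \<and> EN c j' \<in> x}) else 0)"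

definition jump_rate :: "node set \<Rightarrow> node set \<Rightarrow> real" where
  "jump_rate x y =
     (if y = {} then lam_e else 0) +
     (\<Sum>v\<in>nodes m k - x. if y = insert v x then fresh_rate x v else 0)"

definition clustered_gossip :: "'a measure \<Rightarrow> (real \<Rightarrow> 'a \<Rightarrow> node set) \<Rightarrow> bool" where
  "clustered_gossip M X \<longleftrightarrow> ctmc M (Pow (nodes m k)) jump_rate {} X"

end

definition avg_freshness :: "'a measure \<Rightarrow> (real \<Rightarrow> 'a \<Rightarrow> node set) \<Rightarrow> node \<Rightarrow> ereal" where
  "avg_freshness M X v =
     Limsup at_top (\<lambda>T::real. ereal (1 / T *
       (LINT \<omega>|M. (LINT t:{0..T}|lborel. (if v \<in> X t \<omega> then 1 else 0)))))"

end

theory Submission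
  imports Defs
begin

text \<open>
  Time averages of \<open>G f\<close>, with \<open>G\<close> the generator, vanish in the limit for every \<open>f\<close>, so each
  choice of \<open>f\<close> gives a linear relation between long-term averages and no convergence theorem
  for the chain is needed. Taking for \<open>f\<close> the indicators that at least \<open>r\<close> nodes of a group are
  fresh gives a one-step recursion, hence the product for the probability of at least \<open>r\<close> fresh
  nodes. A further test function replaces the exchangeability argument: it shows that a single
  node is fresh with the same average as the fresh fraction of its group. This is applied first
  to the clusterheads and then to the end-nodes of one cluster.
\<close>

section \<open>Time averages of a finite Markov chain\<close>

text \<open>Clusterhead and end-nodes are dependent, yet the answer is a product. The reason is that
  a reset is the only loss of freshness and hits all nodes at once. Let \<open>w r\<close> be the
  average of the event that the clusterhead and at least r of its end-nodes are fresh. Among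
  reachable states, this event for r + 1 is entered only from exactly r fresh end-nodes, at total
  rate \<open>a r\<close>, and left only at rate \<delta>, so
  \<open>\<delta> * w (r + 1) = a r * (w r - w (r + 1))\<close>. Each level thus contributes a
  factor \<open>a r / (a r + \<delta>)\<close>, and level 0 is the freshness of the clusterhead
  itself. The obstacle is that the state space consists of all sets of nodes. The balances fail in
  states with a fresh end-node under a stale clusterhead, so these states are shown to average to 0
  and every balance is read modulo them.\<close>

definition time_avg :: "'a measure \<Rightarrow> (real \<Rightarrow> 'a \<Rightarrow> 's) \<Rightarrow> ('s \<Rightarrow> real) \<Rightarrow> real \<Rightarrow> real" where
  "time_avg M X f T = 1 / T * (LINT \<omega>|M. (LINT t:{0..T}|lborel. f (X t \<omega>)))"

text \<open>The Markov property is taken at time 0 with empty history; together with the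
  deterministic start this identifies the law at every time.\<close>

lemma ctmc_semigroup:
  assumes "ctmc M S r x\<^sub>0 X"
  obtains P where "transition_semigroup S (generator S r) P"
    "\<And>h x y. h \<ge> 0 \<Longrightarrow> x \<in> S \<Longrightarrow> y \<in> S \<Longrightarrow> \<P>(\<omega> in M. X 0 \<omega> = x) > 0 \<Longrightarrow>
      \<P>(\<omega> in M. X h \<omega> = y \<bar> X 0 \<omega> = x) = P h x y"
proof -
  obtain P where P: "transition_semigroup S (generator S r) P \<and>
      (\<forall>t\<ge>0. \<forall>h\<ge>0. \<forall>x\<in>S. \<forall>y\<in>S. \<forall>I \<sigma>. finite I \<longrightarrow> I \<subseteq> {0..<t} \<longrightarrow>
        \<P>(\<omega> in M. X t \<omega> = x \<and> (\<forall>s\<in>I. X s \<omega> = \<sigma> s)) > 0 \<longrightarrow>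
        \<P>(\<omega> in M. X (t + h) \<omega> = y \<bar> X t \<omega> = x \<and> (\<forall>s\<in>I. X s \<omega> = \<sigma> s)) = P h x y)"
    using assms[unfolded ctmc_def, THEN conjunct2, THEN conjunct2, THEN conjunct2,
        THEN conjunct2, THEN conjunct2]
    by (rule exE)
  show thesis
  proof (rule that)
    show "transition_semigroup S (generator S r) P"
      by (rule P[THEN conjunct1])
    show "\<P>(\<omega> in M. X h \<omega> = y \<bar> X 0 \<omega> = x) = P h x y"
      if "h \<ge> 0" "x \<in> S" "y \<in> S" "\<P>(\<omega> in M. X 0 \<omega> = x) > 0" for h x y
      using P[THEN conjunct2, rule_format, of 0 h x y "{}"] that by simp
  qed
qed

section \<open>A finite chain and the regularity of its paths\<close>

locale ctmc_process =
  fixes M :: "'a measure" and S :: "'s set" and r :: "'s \<Rightarrow> 's \<Rightarrow> real" and x\<^sub>0 :: 's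
    and X :: "real \<Rightarrow> 'a \<Rightarrow> 's"
  assumes ctmc: "ctmc M S r x\<^sub>0 X"
begin

lemma prob_space_M: "prob_space M"
  using ctmc by (simp add: ctmc_def)

sublocale prob_space M by (rule prob_space_M)

lemma finite_S: "finite S"
  using ctmc by (simp add: ctmc_def)

lemma measurable_X: "t \<ge> 0 \<Longrightarrow> X t \<in> measurable M (count_space S)"
  using ctmc by (simp add: ctmc_def)

lemma X_in_S: "t \<ge> 0 \<Longrightarrow> \<omega> \<in> space M \<Longrightarrow> X t \<omega> \<in> S"
  using measurable_space[OF measurable_X] by simp

lemma measurable_fX [measurable]: "t \<ge> 0 \<Longrightarrow> (\<lambda>\<omega>. f (X t \<omega>) :: real) \<in> borel_measurable M"
  by (rule measurable_compose[OF measurable_X]) simp_all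

lemma right_continuous:
  assumes "\<omega> \<in> space M" "t \<ge> 0"
  obtains \<epsilon> where "\<epsilon> > 0" "\<And>s. t \<le> s \<Longrightarrow> s < t + \<epsilon> \<Longrightarrow> X s \<omega> = X t \<omega>"
proof -
  have "\<forall>\<omega>\<in>space M. \<forall>t\<ge>0. \<exists>\<epsilon>>0. \<forall>s\<in>{t..<t + \<epsilon>}. X s \<omega> = X t \<omega>"
    using ctmc unfolding ctmc_def by (elim conjE)
  then obtain \<epsilon> where "\<epsilon> > 0" "\<forall>s\<in>{t..<t + \<epsilon>}. X s \<omega> = X t \<omega>"
    using assms by blast
  then show thesis
    using that by (meson atLeastLessThan_iff)
qed

text \<open>A sum instead of a maximum: it still dominates every value, and it tends to 0 as soon as
  each of its finitely many terms does.\<close>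

definition bound :: "('s \<Rightarrow> real) \<Rightarrow> real" where
  "bound f = (\<Sum>z\<in>S. \<bar>f z\<bar>)"

lemma abs_le_bound: "z \<in> S \<Longrightarrow> \<bar>f z\<bar> \<le> bound f"
  unfolding bound_def using finite_S by (intro member_le_sum) auto

lemma bound_nonneg: "bound f \<ge> 0"
  unfolding bound_def by (intro sum_nonneg) auto

text \<open>Fubini needs this, while the chain only provides measurability at each fixed time. The
  \<open>max 0\<close> hides negative times, where X is arbitrary.\<close>

lemma jointly_measurable:
  "(\<lambda>(\<omega>, t). f (X (max 0 t) \<omega>) :: real) \<in> borel_measurable (M \<Otimes>\<^sub>M borel)"
proof -
  \<comment> \<open>\<open>q n t\<close> is a grid point strictly to the right of \<open>t\<close>, so right-continuity applies.\<close>
  define q where "q n t = (real_of_int \<lfloor>real (Suc n) * max 0 t\<rfloor> + 1) / real (Suc n)"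
    for n and t :: real
  have q_lower: "max 0 t \<le> q n t" and q_upper: "q n t \<le> max 0 t + 1 / real (Suc n)" for n t
  proof -
    have "max 0 t * real (Suc n) \<le> real_of_int \<lfloor>real (Suc n) * max 0 t\<rfloor> + 1"
      by (simp only: mult.commute[of "max 0 t"]) linarith
    then show "max 0 t \<le> q n t"
      unfolding q_def by (subst pos_le_divide_eq) simp_all
    have "real_of_int \<lfloor>real (Suc n) * max 0 t\<rfloor> + 1 \<le> real (Suc n) * max 0 t + 1"
      by linarith
    then have "q n t \<le> (real (Suc n) * max 0 t + 1) / real (Suc n)"
      unfolding q_def by (intro divide_right_mono) auto
    then show "q n t \<le> max 0 t + 1 / real (Suc n)"
      by (simp add: add_divide_distrib del: of_nat_Suc)
  qed
  show ?thesis
  proof (rule borel_measurable_LIMSEQ_real)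
    fix p assume "p \<in> space (M \<Otimes>\<^sub>M (borel :: real measure))"
    then obtain \<omega> t where p: "p = (\<omega>, t)" and \<omega>: "\<omega> \<in> space M"
      by (auto simp: space_pair_measure)
    obtain \<epsilon> where \<epsilon>: "\<epsilon> > 0"
      "\<And>s. max 0 t \<le> s \<Longrightarrow> s < max 0 t + \<epsilon> \<Longrightarrow> X s \<omega> = X (max 0 t) \<omega>"
      using right_continuous[OF \<omega>, of "max 0 t"] by (metis max.cobounded1)
    have "eventually (\<lambda>n. 1 / real (Suc n) < \<epsilon>) sequentially"
      using order_tendstoD(2)[OF LIMSEQ_Suc[OF lim_1_over_n] \<epsilon>(1)] by simp
    then have "eventually (\<lambda>n. f (X (q n t) \<omega>) = f (X (max 0 t) \<omega>)) sequentially"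
    proof eventually_elim
      case (elim n)
      then show ?case
        using \<epsilon>(2)[of "q n t"] q_lower[of t n] q_upper[of n t] by simp
    qed
    then show "(\<lambda>n. (\<lambda>(\<omega>, t). f (X (q n t) \<omega>)) p) \<longlonglongrightarrow> (\<lambda>(\<omega>, t). f (X (max 0 t) \<omega>)) p"
      unfolding p by (simp add: tendsto_eventually)
  next
    fix n
    \<comment> \<open>For a fixed integer i the time is constant and only \<omega> varies. The floor
      takes countably many values, so the pieces can be glued. Here \<open>max 0\<close> keeps the
      grid point nonnegative for negative i.\<close>
    have "(\<lambda>p. f (X (max 0 ((real_of_int i + 1) / real (Suc n))) (fst p)))
        \<in> borel_measurable (M \<Otimes>\<^sub>M (borel :: real measure))" for i :: int
      by (rule measurable_compose[OF measurable_fst]) (rule measurable_fX, simp)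
    moreover have "(\<lambda>p. \<lfloor>real (Suc n) * max 0 (snd p)\<rfloor>)
        \<in> measurable (M \<Otimes>\<^sub>M (borel :: real measure)) (count_space UNIV)"
      by measurable
    ultimately have "(\<lambda>p. f (X (max 0 ((real_of_int \<lfloor>real (Suc n) * max 0 (snd p)\<rfloor> + 1)
          / real (Suc n))) (fst p))) \<in> borel_measurable (M \<Otimes>\<^sub>M (borel :: real measure))"
      by (rule measurable_compose_countable)
    moreover have "max 0 ((real_of_int \<lfloor>real (Suc n) * max 0 t\<rfloor> + 1) / real (Suc n)) = q n t" for t
      using q_lower[of t n] by (simp add: q_def)
    ultimately show "(\<lambda>(\<omega>, t). f (X (q n t) \<omega>)) \<in> borel_measurable (M \<Otimes>\<^sub>M borel)"
      by (simp add: case_prod_beta')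
  qed
qed

section \<open>Means at a fixed time and their time averages\<close>

definition mean :: "('s \<Rightarrow> real) \<Rightarrow> real \<Rightarrow> real" where
  "mean f t = (LINT \<omega>|M. f (X t \<omega>))"

lemma integrable_fX: "t \<ge> 0 \<Longrightarrow> integrable M (\<lambda>\<omega>. f (X t \<omega>) :: real)"
  by (rule integrable_const_bound[of _ "bound f"]) (auto intro!: AE_I2 abs_le_bound X_in_S)

lemma mean_mono:
  assumes "t \<ge> 0" "\<And>z. z \<in> S \<Longrightarrow> f z \<le> g z"
  shows "mean f t \<le> mean g t"
  unfolding mean_def using assms X_in_S
  by (intro integral_mono integrable_fX) auto

lemma mean_linear:
  assumes "t \<ge> 0"
  shows "mean (\<lambda>z. a * f z + b * g z) t = a * mean f t + b * mean g t"
  unfolding mean_def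
  using integrable_fX[OF assms, of f] integrable_fX[OF assms, of g] by simp

lemma mean_const: "mean (\<lambda>z. a) t = a"
  unfolding mean_def by (simp add: prob_space)

lemma abs_mean_le:
  assumes "t \<ge> 0" "\<And>z. z \<in> S \<Longrightarrow> \<bar>f z\<bar> \<le> B"
  shows "\<bar>mean f t\<bar> \<le> B"
proof -
  have f_bounds: "f z \<le> B" "- B \<le> f z" if "z \<in> S" for z
    using assms(2)[OF that] by auto
  have "mean f t \<le> mean (\<lambda>_. B) t" "mean (\<lambda>_. - B) t \<le> mean f t"
    using assms(1) by (auto intro!: mean_mono f_bounds)
  then show ?thesis
    by (simp add: mean_const)
qed

lemma mean_eq_sum:
  assumes "t \<ge> 0"
  shows "mean f t = (\<Sum>z\<in>S. \<P>(\<omega> in M. X t \<omega> = z) * f z)"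
proof -
  have X: "{\<omega> \<in> space M. X t \<omega> = z} \<in> sets M" if "z \<in> S" for z
    using measurable_sets[OF measurable_X[OF assms], of "{z}"] that
    by (simp add: vimage_def Int_def conj_commute)
  have "mean f t = (LINT \<omega>|M. (\<Sum>z\<in>S. indicator {\<omega> \<in> space M. X t \<omega> = z} \<omega> * f z))"
    unfolding mean_def
  proof (rule Bochner_Integration.integral_cong)
    fix \<omega> assume \<omega>: "\<omega> \<in> space M"
    have "(\<Sum>z\<in>S. indicator {\<omega> \<in> space M. X t \<omega> = z} \<omega> * f z)
        = (\<Sum>z\<in>S. if X t \<omega> = z then f z else 0)"
      using \<omega> by (intro sum.cong) (auto simp: indicator_def)
    then show "f (X t \<omega>) = (\<Sum>z\<in>S. indicator {\<omega> \<in> space M. X t \<omega> = z} \<omega> * f z)"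
      using X_in_S[OF assms \<omega>] finite_S by simp
  qed simp
  also have "\<dots> = (\<Sum>z\<in>S. \<P>(\<omega> in M. X t \<omega> = z) * f z)"
    using X by (subst Bochner_Integration.integral_sum)
      (auto intro!: integrable_mult_left integrable_real_indicator simp: emeasure_eq_measure)
  finally show ?thesis .
qed

lemma mean_measurable: "(\<lambda>t. mean f (max 0 t)) \<in> borel_measurable borel"
proof -
  have "(\<lambda>(t, \<omega>). f (X (max 0 t) \<omega>)) \<in> borel_measurable (borel \<Otimes>\<^sub>M M)"
    using measurable_compose[OF measurable_pair_swap' jointly_measurable[of f]]
    by (simp add: case_prod_beta')
  then show ?thesis
    unfolding mean_def by (rule borel_measurable_lebesgue_integral)
qed

lemma mean_integrable:
  assumes "0 \<le> a"
  shows "set_integrable lborel {a..b} (mean f)"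
proof -
  have "integrable lborel (\<lambda>t. indicator {a..b} t *\<^sub>R mean f (max 0 t))"
  proof (rule Bochner_Integration.integrable_bound)
    show "integrable lborel (\<lambda>t. indicator {a..b} t *\<^sub>R bound f)"
      by (intro integrable_scaleR_left integrable_real_indicator) (auto simp: emeasure_lborel_Icc_eq)
    show "(\<lambda>t. indicator {a..b} t *\<^sub>R mean f (max 0 t)) \<in> borel_measurable lborel"
      using mean_measurable[of f] by measurable
    have "\<bar>mean f (max 0 t)\<bar> \<le> bound f" for t
      by (intro abs_mean_le abs_le_bound) auto
    then show "AE t in lborel. norm (indicator {a..b} t *\<^sub>R mean f (max 0 t))
        \<le> norm (indicator {a..b} t *\<^sub>R bound f)"
      by (intro AE_I2) (simp add: indicator_def bound_nonneg)
  qed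
  then show ?thesis
    unfolding set_integrable_def
    by (rule Bochner_Integration.integrable_cong[THEN iffD1, rotated -1])
       (use assms in \<open>auto simp: indicator_def max_def\<close>)
qed

text \<open>Fubini reduces time averages to the one-dimensional laws of the chain.\<close>

lemma time_avg_eq: "time_avg M X f T = 1 / T * (LINT t:{0..T}|lborel. mean f t)"
proof -
  have "emeasure (lborel \<Otimes>\<^sub>M M) ({0..T} \<times> space M) = emeasure lborel {0..T}"
    by (subst emeasure_pair_measure_Times) (auto simp: emeasure_space_1)
  then have finite: "emeasure (lborel \<Otimes>\<^sub>M M) ({0..T} \<times> space M) < \<infinity>"
    by (simp add: emeasure_lborel_Icc_eq)
  interpret pair_sigma_finite lborel M
    by unfold_locales
  let ?g = "\<lambda>t \<omega>. indicator {0..T} t *\<^sub>R f (X (max 0 t) \<omega>)"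
  have meas: "case_prod ?g \<in> borel_measurable (lborel \<Otimes>\<^sub>M M)"
  proof -
    have "(\<lambda>(t, \<omega>). f (X (max 0 t) \<omega>)) \<in> borel_measurable (lborel \<Otimes>\<^sub>M M)"
      using measurable_compose[OF measurable_pair_swap' jointly_measurable[of f]]
      by (simp add: case_prod_beta' cong: measurable_cong_sets)
    then show ?thesis
      unfolding case_prod_beta' by measurable
  qed
  have "integrable (lborel \<Otimes>\<^sub>M M) (\<lambda>p. indicator ({0..T} \<times> space M) p *\<^sub>R bound f)"
    by (intro integrable_scaleR_left integrable_real_indicator pair_measureI)
       (use finite in auto)
  then have "integrable (lborel \<Otimes>\<^sub>M M) (case_prod ?g)"
    by (rule Bochner_Integration.integrable_bound[OF _ meas])
       (auto intro!: AE_I2 abs_le_bound X_in_S simp: space_pair_measure bound_nonneg indicator_def)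
  from Fubini_integral[OF this]
  have *: "(LINT \<omega>|M. LINT t|lborel. ?g t \<omega>) = (LINT t|lborel. LINT \<omega>|M. ?g t \<omega>)" .
  have "(LINT t:{0..T}|lborel. f (X t \<omega>)) = (LINT t|lborel. ?g t \<omega>)" for \<omega>
    unfolding set_lebesgue_integral_def
    by (rule Bochner_Integration.integral_cong) (auto simp: indicator_def max_def)
  moreover have "(LINT t:{0..T}|lborel. mean f t) = (LINT t|lborel. LINT \<omega>|M. ?g t \<omega>)"
    unfolding set_lebesgue_integral_def mean_def
    by (rule Bochner_Integration.integral_cong) (auto simp: indicator_def max_def)
  ultimately show ?thesis
    unfolding time_avg_def using * by simp
qed

lemma time_avg_linear:
  "time_avg M X (\<lambda>z. a * f z + b * g z) T = a * time_avg M X f T + b * time_avg M X g T"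
proof -
  have "(LINT t:{0..T}|lborel. mean (\<lambda>z. a * f z + b * g z) t)
      = (LINT t:{0..T}|lborel. a * mean f t + b * mean g t)"
    by (intro set_lebesgue_integral_cong) (auto simp: mean_linear)
  also have "\<dots> = a * (LINT t:{0..T}|lborel. mean f t) + b * (LINT t:{0..T}|lborel. mean g t)"
    using mean_integrable[of 0 T f] mean_integrable[of 0 T g] by simp
  finally show ?thesis
    unfolding time_avg_eq by (simp add: algebra_simps)
qed

lemma time_avg_mono:
  assumes "\<And>z. z \<in> S \<Longrightarrow> f z \<le> g z" "T \<ge> 0"
  shows "time_avg M X f T \<le> time_avg M X g T"
proof -
  have "(LINT t:{0..T}|lborel. mean f t) \<le> (LINT t:{0..T}|lborel. mean g t)"
    by (rule set_integral_mono) (auto intro!: mean_integrable mean_mono assms)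
  then show ?thesis
    unfolding time_avg_eq using \<open>T \<ge> 0\<close> by (intro mult_left_mono) auto
qed

lemma time_avg_cong:
  "(\<And>z. z \<in> S \<Longrightarrow> f z = g z) \<Longrightarrow> T \<ge> 0 \<Longrightarrow> time_avg M X f T = time_avg M X g T"
  by (rule antisym) (auto intro: time_avg_mono)

lemma time_avg_const: "T > 0 \<Longrightarrow> time_avg M X (\<lambda>z. a) T = a"
  by (simp add: time_avg_def set_lebesgue_integral_def prob_space)

lemma time_avg_bound:
  assumes "\<And>z. z \<in> S \<Longrightarrow> \<bar>f z\<bar> \<le> B" "T > 0"
  shows "\<bar>time_avg M X f T\<bar> \<le> B"
proof -
  have f_bounds: "f z \<le> B" "- B \<le> f z" if "z \<in> S" for z
    using assms(1)[OF that] by auto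
  have "time_avg M X f T \<le> time_avg M X (\<lambda>_. B) T"
    by (rule time_avg_mono) (use f_bounds assms(2) in simp_all)
  moreover have "time_avg M X (\<lambda>_. - B) T \<le> time_avg M X f T"
    by (rule time_avg_mono) (use f_bounds assms(2) in simp_all)
  ultimately show ?thesis
    using assms(2) by (simp add: time_avg_const)
qed

section \<open>The generator and the vanishing of its time averages\<close>

definition gen :: "('s \<Rightarrow> real) \<Rightarrow> 's \<Rightarrow> real" where
  "gen f x = (\<Sum>y\<in>S. r x y * (f y - f x))"

text \<open>The difference form gives \<open>r x x\<close> the weight 0, so self-jumps such as a
  reset in the empty state do no harm; the terms with \<open>f x\<close> collect into the diagonal
  entry of the generator.\<close>

lemma gen_eq: "x \<in> S \<Longrightarrow> gen f x = (\<Sum>y\<in>S. generator S r x y * f y)"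
proof -
  assume x: "x \<in> S"
  have "gen f x = (\<Sum>y\<in>S - {x}. r x y * (f y - f x))"
    unfolding gen_def by (rule sum.mono_neutral_right) (use finite_S in auto)
  also have "\<dots> = (\<Sum>y\<in>S - {x}. r x y * f y) - (\<Sum>y\<in>S - {x}. r x y) * f x"
    by (simp add: sum_subtractf sum_distrib_right right_diff_distrib)
  also have "\<dots> = (\<Sum>y\<in>S - {x}. generator S r x y * f y) + generator S r x x * f x"
  proof -
    have "(\<Sum>y\<in>S - {x}. generator S r x y * f y) = (\<Sum>y\<in>S - {x}. r x y * f y)"
      unfolding generator_def by (rule sum.cong) auto
    then show ?thesis
      by (simp add: generator_def)
  qed
  also have "\<dots> = (\<Sum>y\<in>S. generator S r x y * f y)"
    using sum.remove[OF finite_S x, of "\<lambda>y. generator S r x y * f y"] by simp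
  finally show ?thesis .
qed

text \<open>The start is almost surely \<open>x\<^sub>0\<close>, so conditioning on it changes no
  probability and the law at time t is the row \<open>P t x\<^sub>0\<close>. Chapman-Kolmogorov then
  moves the step h from the time onto the function.\<close>

lemma semigroup_exists:
  obtains P where "transition_semigroup S (generator S r) P"
    "\<And>f t h. t \<ge> 0 \<Longrightarrow> h \<ge> 0 \<Longrightarrow> mean f (t + h) = mean (\<lambda>z. \<Sum>y\<in>S. P h z y * f y) t"
proof (rule ctmc_semigroup[OF ctmc])
  fix P
  assume sg: "transition_semigroup S (generator S r) P"
    and markov: "\<And>h x y. h \<ge> 0 \<Longrightarrow> x \<in> S \<Longrightarrow> y \<in> S \<Longrightarrow> \<P>(\<omega> in M. X 0 \<omega> = x) > 0 \<Longrightarrow>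
      \<P>(\<omega> in M. X h \<omega> = y \<bar> X 0 \<omega> = x) = P h x y"
  have init: "AE \<omega> in M. X 0 \<omega> = x\<^sub>0"
    using ctmc by (simp add: ctmc_def)
  have x0: "x\<^sub>0 \<in> S"
  proof -
    have "AE \<omega> in M. x\<^sub>0 \<in> S"
      using init AE_space by eventually_elim (use X_in_S[of 0] in auto)
    then show ?thesis
      by simp
  qed
  have X: "{\<omega> \<in> space M. X t \<omega> = z} \<in> sets M" if "z \<in> S" "t \<ge> 0" for z t
    using measurable_sets[OF measurable_X[OF that(2)], of "{z}"] that
    by (simp add: vimage_def Int_def conj_commute)
  have p0: "\<P>(\<omega> in M. X 0 \<omega> = x\<^sub>0) = 1"
    using prob_eq_1[OF X[OF x0, of 0]] init by (auto elim: AE_mp)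
  have law: "\<P>(\<omega> in M. X t \<omega> = y) = P t x\<^sub>0 y" if "t \<ge> 0" "y \<in> S" for t y
  proof -
    have "P t x\<^sub>0 y = \<P>(\<omega> in M. X t \<omega> = y \<bar> X 0 \<omega> = x\<^sub>0)"
      using markov[of t x\<^sub>0 y] that x0 p0 by simp
    also have "\<dots> = \<P>(\<omega> in M. X t \<omega> = y \<and> X 0 \<omega> = x\<^sub>0)"
      by (simp add: cond_prob_def p0)
    also have "\<dots> = \<P>(\<omega> in M. X t \<omega> = y)"
    proof (rule finite_measure_eq_AE)
      show "AE \<omega> in M. (\<omega> \<in> {\<omega> \<in> space M. X t \<omega> = y \<and> X 0 \<omega> = x\<^sub>0})
          = (\<omega> \<in> {\<omega> \<in> space M. X t \<omega> = y})"
        using init by eventually_elim auto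
      have "{\<omega> \<in> space M. X t \<omega> = y \<and> X 0 \<omega> = x\<^sub>0}
          = {\<omega> \<in> space M. X t \<omega> = y} \<inter> {\<omega> \<in> space M. X 0 \<omega> = x\<^sub>0}"
        by auto
      then show "{\<omega> \<in> space M. X t \<omega> = y \<and> X 0 \<omega> = x\<^sub>0} \<in> sets M"
        using X that x0 by auto
    qed (use X that in auto)
    finally show ?thesis ..
  qed
  have "mean f (t + h) = mean (\<lambda>z. \<Sum>y\<in>S. P h z y * f y) t" if "t \<ge> 0" "h \<ge> 0" for f t h
  proof -
    have "mean f (t + h) = (\<Sum>y\<in>S. P (t + h) x\<^sub>0 y * f y)"
      using that by (simp add: mean_eq_sum law)
    also have "\<dots> = (\<Sum>y\<in>S. (\<Sum>z\<in>S. P t x\<^sub>0 z * P h z y) * f y)"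
      using sg that x0 by (intro sum.cong) (auto simp: transition_semigroup_def)
    also have "\<dots> = (\<Sum>y\<in>S. \<Sum>z\<in>S. P t x\<^sub>0 z * (P h z y * f y))"
      by (simp add: sum_distrib_right mult.assoc)
    also have "\<dots> = (\<Sum>z\<in>S. P t x\<^sub>0 z * (\<Sum>y\<in>S. P h z y * f y))"
      by (subst sum.swap) (simp add: sum_distrib_left)
    also have "\<dots> = mean (\<lambda>z. \<Sum>y\<in>S. P h z y * f y) t"
      using that by (simp add: mean_eq_sum law)
    finally show ?thesis .
  qed
  with sg show thesis by (rule that)
qed

text \<open>Avoids differentiating the semigroup at positive times: the time average of the difference
  quotient of \<open>f\<close> over a step \<open>h\<close> is \<open>O(1 / T)\<close>, and only then is \<open>h\<close> sent to 0.\<close>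

lemma shift_integral_diff:
  assumes "0 \<le> h" "0 \<le> T"
  shows "\<bar>(LINT t:{0..T}|lborel. mean f (t + h)) - (LINT t:{0..T}|lborel. mean f t)\<bar> \<le> 2 * h * bound f"
proof -
  have int: "integrable lborel (\<lambda>t. indicator {a..b} t *\<^sub>R mean f t)" if "0 \<le> a" for a b
    using mean_integrable[OF that] unfolding set_integrable_def .
  have "(LINT t:{0..T}|lborel. mean f (t + h)) = (LINT t:{h..T + h}|lborel. mean f t)"
    unfolding set_lebesgue_integral_def
    by (subst (2) lborel_integral_real_affine[of 1 _ h])
       (auto intro!: Bochner_Integration.integral_cong simp: indicator_def add.commute)
  then have diff: "(LINT t:{0..T}|lborel. mean f (t + h)) - (LINT t:{0..T}|lborel. mean f t)
      = (LINT t|lborel. indicator {h..T + h} t *\<^sub>R mean f t - indicator {0..T} t *\<^sub>R mean f t)"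
    using int[of h] int[of 0] assms by (simp add: set_lebesgue_integral_def)
  \<comment> \<open>The two windows differ only inside \<open>{0..h}\<close> and
    \<open>{T..T + h}\<close>, even if h exceeds T. Both have length h.\<close>
  have "\<bar>LINT t|lborel. indicator {h..T + h} t *\<^sub>R mean f t - indicator {0..T} t *\<^sub>R mean f t\<bar>
      \<le> (LINT t|lborel. indicator {0..h} t * bound f + indicator {T..T + h} t * bound f)"
  proof (rule integral_abs_bound[THEN order_trans], rule integral_mono)
    show "integrable lborel (\<lambda>t. \<bar>indicator {h..T + h} t *\<^sub>R mean f t - indicator {0..T} t *\<^sub>R mean f t\<bar>)"
      using int[of h] int[of 0] assms by auto
    show "integrable lborel (\<lambda>t. indicator {0..h} t * bound f + indicator {T..T + h} t * bound f)"
      by (intro Bochner_Integration.integrable_add integrable_mult_left integrable_real_indicator)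
         (auto simp: emeasure_lborel_Icc_eq)
    fix t :: real
    show "\<bar>indicator {h..T + h} t *\<^sub>R mean f t - indicator {0..T} t *\<^sub>R mean f t\<bar>
        \<le> indicator {0..h} t * bound f + indicator {T..T + h} t * bound f"
    proof (cases "t \<ge> 0")
      case True
      then have "\<bar>mean f t\<bar> \<le> bound f"
        by (intro abs_mean_le abs_le_bound)
      then show ?thesis
        using True bound_nonneg[of f] assms by (auto simp: indicator_def)
    next
      case False
      then show ?thesis
        using bound_nonneg[of f] assms by (simp add: indicator_def)
    qed
  qed
  also have "\<dots> = (h - 0) * bound f + (T + h - T) * bound f"
  proof (intro has_bochner_integral_integral_eq has_bochner_integral_add has_bochner_integral_mult_left)
    have Icc: "has_bochner_integral lborel (indicator {a..b}) (b - a)" if "a \<le> b" for a b :: real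
      using has_bochner_integral_real_indicator[of "{a..b}" lborel] that
      by (simp add: emeasure_lborel_Icc_eq)
    show "has_bochner_integral lborel (indicator {0..h}) (h - 0)"
      "has_bochner_integral lborel (indicator {T..T + h}) (T + h - T)"
      using Icc[of 0 h] Icc[of T "T + h"] assms by simp_all
  qed
  finally show ?thesis
    unfolding diff by simp
qed

text \<open>Write \<open>gen f\<close> as the difference quotient of the semigroup minus the
  remainder \<open>q h\<close>. The quotient averages to at most \<open>2 * bound f / T\<close>,
  since its \<open>1 / h\<close> cancels the h of the shift estimate; the remainder is at most
  \<open>bound (q h)\<close> for every T. So h can be fixed first and T sent to infinity
  afterwards.\<close>

lemma time_avg_gen: "((\<lambda>T. time_avg M X (gen f) T) \<longlongrightarrow> 0) at_top"
proof (rule semigroup_exists)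
  fix P
  assume P: "transition_semigroup S (generator S r) P"
    and shift: "\<And>f t h. t \<ge> 0 \<Longrightarrow> h \<ge> 0 \<Longrightarrow> mean f (t + h) = mean (\<lambda>z. \<Sum>y\<in>S. P h z y * f y) t"
  define Pf where "Pf h z = (\<Sum>y\<in>S. P h z y * f y)" for h z
  define q where "q h z = (Pf h z - f z) / h - gen f z" for h z
  have q_lim: "((\<lambda>h. q h z) \<longlongrightarrow> 0) (at_right 0)" if z: "z \<in> S" for z
  proof -
    have "((\<lambda>h. (P h z y - P 0 z y) / (h - 0)) \<longlongrightarrow> generator S r z y) (at_right 0)"
      if "y \<in> S" for y
    proof -
      have "((\<lambda>h. P h z y) has_real_derivative generator S r z y) (at 0 within {0..})"
        using P z that by (simp add: transition_semigroup_def)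
      then have "((\<lambda>h. (P h z y - P 0 z y) / (h - 0)) \<longlongrightarrow> generator S r z y) (at 0 within {0..})"
        by (simp add: has_field_derivative_iff)
      then show ?thesis
        by (rule tendsto_within_subset) auto
    qed
    then have "((\<lambda>h. \<Sum>y\<in>S. (P h z y - P 0 z y) / (h - 0) * f y)
        \<longlongrightarrow> (\<Sum>y\<in>S. generator S r z y * f y)) (at_right 0)"
      by (intro tendsto_sum tendsto_mult_right)
    moreover have "(\<Sum>y\<in>S. (P h z y - P 0 z y) / (h - 0) * f y) = (Pf h z - f z) / h" for h
    proof -
      have "(\<Sum>y\<in>S. P 0 z y * f y) = (\<Sum>y\<in>S. if z = y then f y else 0)"
        using P z by (intro sum.cong) (auto simp: transition_semigroup_def)
      then have "f z = (\<Sum>y\<in>S. P 0 z y * f y)"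
        using z finite_S by simp
      then show ?thesis
        by (simp add: Pf_def diff_divide_distrib left_diff_distrib sum_subtractf sum_divide_distrib)
    qed
    ultimately have "((\<lambda>h. (Pf h z - f z) / h) \<longlongrightarrow> gen f z) (at_right 0)"
      using gen_eq[OF z, of f] by simp
    then show ?thesis
      unfolding q_def by (rule LIM_zero)
  qed
  have "((\<lambda>h. bound (q h)) \<longlongrightarrow> (\<Sum>z\<in>S. \<bar>0\<bar>)) (at_right 0)"
    unfolding bound_def by (intro tendsto_sum tendsto_rabs q_lim)
  then have bound_lim: "((\<lambda>h. bound (q h)) \<longlongrightarrow> 0) (at_right 0)"
    by simp
  have le: "\<bar>time_avg M X (gen f) T\<bar> \<le> 2 * bound f / T + bound (q h)" if "h > 0" "T > 0" for h T
  proof -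
    have "gen f = (\<lambda>z. 1 * (1 / h * Pf h z + (- 1 / h) * f z) + (- 1) * q h z)"
      using that by (auto simp: q_def diff_divide_distrib)
    then have "time_avg M X (gen f) T
        = 1 / h * (time_avg M X (Pf h) T - time_avg M X f T) - time_avg M X (q h) T"
      by (simp only: time_avg_linear) (simp add: right_diff_distrib)
    moreover have "\<bar>time_avg M X (q h) T\<bar> \<le> bound (q h)"
      using that by (intro time_avg_bound abs_le_bound)
    moreover have "\<bar>1 / h * (time_avg M X (Pf h) T - time_avg M X f T)\<bar> \<le> 2 * bound f / T"
    proof -
      have "(LINT t:{0..T}|lborel. mean (Pf h) t) = (LINT t:{0..T}|lborel. mean f (t + h))"
        using shift[of _ h f] that
        by (intro set_lebesgue_integral_cong) (auto simp: Pf_def[abs_def])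
      then have "\<bar>time_avg M X (Pf h) T - time_avg M X f T\<bar> \<le> 1 / T * (2 * h * bound f)"
        using shift_integral_diff[of h T f] that
        by (simp add: time_avg_eq abs_mult divide_right_mono flip: right_diff_distrib diff_divide_distrib)
      then have "1 / h * \<bar>time_avg M X (Pf h) T - time_avg M X f T\<bar> \<le> 1 / h * (1 / T * (2 * h * bound f))"
        using that by (intro mult_left_mono) auto
      then show ?thesis
        using that by (simp add: abs_mult)
    qed
    ultimately show ?thesis
      by linarith
  qed
  show ?thesis
  proof (rule tendstoI)
    fix \<epsilon> :: real assume \<epsilon>: "\<epsilon> > 0"
    have "eventually (\<lambda>h. bound (q h) < \<epsilon> / 2 \<and> h > 0) (at_right 0)"
      using order_tendstoD(2)[OF bound_lim, of "\<epsilon> / 2"] \<epsilon>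
      by (intro eventually_conj) (auto simp: eventually_at_right_less)
    then obtain h where h: "bound (q h) < \<epsilon> / 2" "h > 0"
      using eventually_happens[of _ "at_right (0::real)"] by auto
    have "((\<lambda>T. 2 * bound f / T) \<longlongrightarrow> 0) at_top"
      by (intro tendsto_divide_0[OF tendsto_const] filterlim_at_top_imp_at_infinity filterlim_ident)
    then have "eventually (\<lambda>T. 2 * bound f / T < \<epsilon> / 2) at_top"
      using \<epsilon> by (intro order_tendstoD(2)) auto
    then show "eventually (\<lambda>T. dist (time_avg M X (gen f) T) 0 < \<epsilon>) at_top"
      using eventually_gt_at_top[of 0]
    proof eventually_elim
      case (elim T)
      then show ?case
        using le[OF h(2), of T] h(1) by (simp add: dist_real_def)
    qed
  qed
qed

end

section \<open>Groups of nodes growing between resets\<close>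

text \<open>\<open>L f l\<close> stands for: the long-term average of \<open>f\<close> exists and equals \<open>l\<close>.\<close>

locale reset_growth =
  fixes N :: "'n set" and \<phi> :: "'n set \<Rightarrow> 'n \<Rightarrow> real" and \<delta> :: real
    and L :: "('n set \<Rightarrow> real) \<Rightarrow> real \<Rightarrow> bool"
  assumes finite_N: "finite N"
    and \<delta>_pos: "\<delta> > 0"
    and L_one: "L (\<lambda>_. 1) 1"
    and L_linear: "L f l \<Longrightarrow> L g l' \<Longrightarrow> L (\<lambda>x. a * f x + b * g x) (a * l + b * l')"
    and L_squeeze: "(\<And>x. x \<subseteq> N \<Longrightarrow> \<bar>f x\<bar> \<le> g x) \<Longrightarrow> L g 0 \<Longrightarrow> L f 0"
    and L_generator:
      "L (\<lambda>x. \<delta> * (f {} - f x) + (\<Sum>v\<in>N - x. \<phi> x v * (f (insert v x) - f x))) 0"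
begin

section \<open>Calculus of long-term averages\<close>

definition G :: "('n set \<Rightarrow> real) \<Rightarrow> 'n set \<Rightarrow> real" where
  "G f x = \<delta> * (f {} - f x) + (\<Sum>v\<in>N - x. \<phi> x v * (f (insert v x) - f x))"

lemma L_G: "L (G f) 0"
  unfolding G_def by (rule L_generator)

lemma L_cmult: "L f l \<Longrightarrow> L (\<lambda>x. a * f x) (a * l)"
  using L_linear[of f l f l a 0] by simp

lemma L_add: "L f l \<Longrightarrow> L g l' \<Longrightarrow> L (\<lambda>x. f x + g x) (l + l')"
  using L_linear[of f l g l' 1 1] by simp

lemma L_diff: "L f l \<Longrightarrow> L g l' \<Longrightarrow> L (\<lambda>x. f x - g x) (l - l')"
  using L_linear[of f l g l' 1 "-1"] by simp

lemma L_zero: "L (\<lambda>_. 0) 0"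
  using L_cmult[OF L_one, of 0] by simp

text \<open>An identity is needed only where e vanishes; elsewhere any crude bound C will do,
  because e averages to 0.\<close>

lemma L_perturb:
  assumes f: "L f l" and e: "L e 0" and le: "\<And>x. x \<subseteq> N \<Longrightarrow> \<bar>g x - f x\<bar> \<le> C * e x"
  shows "L g l"
proof -
  have "L (\<lambda>x. g x - f x) 0"
    using L_cmult[OF e, of C] by (intro L_squeeze[OF le]) auto
  from L_add[OF f this] show ?thesis
    by simp
qed

lemma L_cong: "L f l \<Longrightarrow> (\<And>x. x \<subseteq> N \<Longrightarrow> g x = f x) \<Longrightarrow> L g l"
  by (rule L_perturb[OF _ L_zero, where C = 0]) auto

lemma L_sum:
  assumes "finite I" "\<And>i. i \<in> I \<Longrightarrow> L (f i) (l i)"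
  shows "L (\<lambda>x. \<Sum>i\<in>I. f i x) (\<Sum>i\<in>I. l i)"
  using assms by (induction I rule: finite_induct) (auto simp: L_zero intro: L_add)

text \<open>States with \<open>\<not> A x\<close> and a fresh node in \<open>V\<close> are unreachable in the application but belong to
  the state space, hence the assumption that they are negligible on average.\<close>

lemma growth_average:
  fixes V :: "'n set" and A :: "'n set \<Rightarrow> bool" and b :: "nat \<Rightarrow> real"
  defines "K \<equiv> card V"
  assumes V: "V \<subseteq> N" and j: "j \<in> V"
    and rate: "\<And>x v. x \<subseteq> N \<Longrightarrow> v \<in> V - x \<Longrightarrow>
      \<phi> x v = (if A x then b (card (V \<inter> x)) else 0)"
    and b_nonneg: "\<And>l. l < K \<Longrightarrow> b l \<ge> 0"
    and inactive: "L (\<lambda>x. of_bool (\<not> A x \<and> V \<inter> x \<noteq> {})) 0"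
    and active: "L (\<lambda>x. of_bool (A x)) p"
  shows "L (\<lambda>x. of_bool (j \<in> x))
    (p * (1 / real K * (\<Sum>r=1..K. \<Prod>i=1..r.
      (real K - real i + 1) * b (i - 1) / ((real K - real i + 1) * b (i - 1) + \<delta>))))"
proof -
  define c where "c x = card (V \<inter> x)" for x
  define e :: "'n set \<Rightarrow> real" where "e x = of_bool (\<not> A x \<and> V \<inter> x \<noteq> {})" for x
  \<comment> \<open>Total rate at which an active group with l fresh nodes gains one more.\<close>
  define a where "a l = (real K - real l) * b l" for l
  have fin_V: "finite V"
    using V finite_N by (rule finite_subset)
  have K_pos: "K > 0"
    unfolding K_def using j fin_V by (auto simp: card_gt_0_iff)
  have c_le: "c x \<le> K" for x
    unfolding c_def K_def using fin_V by (intro card_mono) auto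
  have c_0: "c x = 0 \<longleftrightarrow> V \<inter> x = {}" for x
    unfolding c_def using fin_V by simp
  have c_empty: "c {} = 0"
    unfolding c_def by simp
  have card_stale: "real (card (V - x)) = real K - real (c x)" for x
    unfolding K_def c_def using card_Int_Diff[of V x] fin_V by (simp add: Int_commute)
  have c_insert: "c (insert v x) = Suc (c x)" if "v \<in> V - x" for v x
    unfolding c_def using that fin_V by (simp add: Int_insert_right)
  have c_insert_other: "c (insert v x) = c x" if "v \<notin> V" for v x
    unfolding c_def using that by (simp add: Int_insert_right)
  have c_less: "c x < K" if "v \<in> V - x" for v x
    using c_le[of "insert v x"] c_insert[OF that] by simp
  \<comment> \<open>At l = K the stale count is 0, so the sign of \<open>b K\<close> does not
    matter.\<close>
  have a_nonneg: "a l \<ge> 0" if "l \<le> K" for l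
    using b_nonneg[of l] that unfolding a_def by (cases "l = K") auto
  have e_null: "L e 0"
    unfolding e_def by (rule inactive)

  \<comment> \<open>If f ignores the nodes outside V, their rates cancel and only the common rate
    within V and the reset remain.\<close>
  have G_V: "G f x = \<delta> * (f {} - f x) +
      (if A x then b (c x) * (\<Sum>v\<in>V - x. f (insert v x) - f x) else 0)"
    if x: "x \<subseteq> N" and f: "\<And>v. v \<in> N - V \<Longrightarrow> f (insert v x) = f x" for f x
  proof -
    have "(\<Sum>v\<in>N - x. \<phi> x v * (f (insert v x) - f x))
        = (\<Sum>v\<in>V - x. \<phi> x v * (f (insert v x) - f x))"
      using V f finite_N by (intro sum.mono_neutral_right) auto
    also have "\<dots> = (if A x then b (c x) * (\<Sum>v\<in>V - x. f (insert v x) - f x) else 0)"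
      using rate[OF x] by (simp add: c_def sum_distrib_left)
    finally show ?thesis
      unfolding G_def by simp
  qed

  have level: "L (\<lambda>x. of_bool (A x \<and> c x \<ge> r))
      (p * (\<Prod>i<r. a i / (a i + \<delta>)))" if "r \<le> K" for r
    using that
  proof (induction r)
    case 0
    then show ?case using active by simp
  next
    case (Suc r)
    \<comment> \<open>The test function leaves A out, since the rates at which A changes are not
      known here. A re-enters through the growth rate, and f agrees with \<open>w (Suc r)\<close> up
      to the negligible e.\<close>
    define f :: "'n set \<Rightarrow> real" where "f x = of_bool (c x \<ge> Suc r)" for x
    define w :: "nat \<Rightarrow> 'n set \<Rightarrow> real" where "w s x = of_bool (A x \<and> c x \<ge> s)" for s x
    have pos: "a r + \<delta> > 0"
      using a_nonneg[of r] Suc.prems \<delta>_pos by simp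
    have G_f: "G f x = - \<delta> * f x + a r * (w r x - w (Suc r) x)" if x: "x \<subseteq> N" for x
    proof -
      have "(\<Sum>v\<in>V - x. f (insert v x) - f x) = (\<Sum>v\<in>V - x. of_bool (c x = r))"
        by (intro sum.cong) (auto simp: f_def c_insert)
      also have "\<dots> = (real K - real (c x)) * of_bool (c x = r)"
        by (simp add: card_stale)
      finally have "G f x = - \<delta> * f x
          + (if A x then b (c x) * ((real K - real (c x)) * of_bool (c x = r)) else 0)"
        using G_V[of x f] x by (simp add: f_def c_insert_other c_empty)
      then show ?thesis
        by (cases "c x = r") (auto simp: w_def a_def)
    qed
    have f_eq: "f x = w (Suc r) x + of_bool (c x \<ge> Suc r) * e x" for x
      using c_0[of x] by (auto simp: f_def w_def e_def)
    \<comment> \<open>\<open>G_f\<close> solved for \<open>w (Suc r)\<close>; replacing f by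
      \<open>w (Suc r)\<close> costs at most \<delta> times e before the division.\<close>
    have "L (\<lambda>x. (a r * w r x - G f x) / (a r + \<delta>))
        ((a r * (p * (\<Prod>i<r. a i / (a i + \<delta>))) - 0) / (a r + \<delta>))"
      using L_cmult[OF L_diff[OF L_cmult[OF Suc.IH, of "a r"] L_G[of f]], of "1 / (a r + \<delta>)"]
        Suc.prems by (simp add: w_def)
    then have "L (\<lambda>x. w (Suc r) x) ((a r * (p * (\<Prod>i<r. a i / (a i + \<delta>))) - 0) / (a r + \<delta>))"
    proof (rule L_perturb[OF _ e_null, where C = "\<delta> / (a r + \<delta>)"])
      fix x assume x: "x \<subseteq> N"
      have "w (Suc r) x - (a r * w r x - G f x) / (a r + \<delta>)
          = ((a r + \<delta>) * w (Suc r) x - (a r * w r x - G f x)) / (a r + \<delta>)"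
        using pos by (simp add: diff_divide_distrib)
      also have "(a r + \<delta>) * w (Suc r) x - (a r * w r x - G f x)
          = - \<delta> * of_bool (c x \<ge> Suc r) * e x"
        unfolding G_f[OF x] f_eq by (simp add: algebra_simps)
      finally show "\<bar>w (Suc r) x - (a r * w r x - G f x) / (a r + \<delta>)\<bar> \<le> \<delta> / (a r + \<delta>) * e x"
        using pos \<delta>_pos by (simp add: e_def)
    qed
    then show ?case
      by (simp add: w_def mult_ac)
  qed

  have count_avg: "L (\<lambda>x. real (c x)) (p * (\<Sum>r=1..K. \<Prod>i<r. a i / (a i + \<delta>)))"
  proof -
    \<comment> \<open>A count is the sum of its level indicators.\<close>
    have "L (\<lambda>x. \<Sum>r=1..K. of_bool (A x \<and> c x \<ge> r))
        (\<Sum>r=1..K. p * (\<Prod>i<r. a i / (a i + \<delta>)))"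
      by (intro L_sum level) auto
    then show ?thesis
      unfolding sum_distrib_left
    proof (rule L_perturb[OF _ e_null, where C = "real K"])
      fix x
      have "real (c x) = (\<Sum>r=1..K. of_bool (c x \<ge> r))"
      proof -
        have "{1..K} \<inter> {r. r \<le> c x} = {1..c x}"
          using c_le[of x] by auto
        then show ?thesis
          by (simp add: of_bool_def sum.If_cases)
      qed
      then show "\<bar>real (c x) - (\<Sum>r=1..K. of_bool (A x \<and> c x \<ge> r))\<bar> \<le> real K * e x"
        using c_le[of x] c_0[of x] by (auto simp: e_def)
    qed
  qed

  \<comment> \<open>\<open>G\<close> maps \<open>d\<close> times a function \<open>s\<close> of the count to a multiple of \<open>d\<close>; \<open>s\<close> is chosen, by
    recursion downwards from \<open>K\<close>, so that the result is \<open>- d\<close> on active states.\<close>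
  define d where "d x = of_bool (j \<in> x) - real (c x) / real K" for x
  have d_null: "L d 0"
  proof -
    \<comment> \<open>\<open>t n\<close> is the value of s with n stale nodes, which turns the
      downward recursion into a primitive one. The start \<open>1 / \<delta>\<close> solves the
      equation for l = K, where nothing is left to grow.\<close>
    define t where "t = rec_nat (1 / \<delta>)
      (\<lambda>n y. (1 + b (K - Suc n) * real n * y) / (\<delta> + (real n + 1) * b (K - Suc n)))"
    define s where "s l = t (K - l)" for l
    \<comment> \<open>The demand that G send \<open>d * s\<close> to \<open>- d\<close>: with y
      stale nodes, d summed over the y possible insertions is \<open>(y - 1) * d\<close>, shown
      below as \<open>d_sum\<close>.\<close>
    have s_eq: "\<delta> * s l + b l * ((real K - real l) * s l - (real K - real l - 1) * s (Suc l)) = 1"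
      if "l < K" for l
    proof -
      define n where "n = K - Suc l"
      have n: "K - l = Suc n" "K - Suc n = l" "real K - real l = real n + 1"
        using that by (auto simp: n_def of_nat_diff)
      have pos: "\<delta> + (real n + 1) * b l > 0"
        using \<delta>_pos b_nonneg[OF that] by (intro add_pos_nonneg) auto
      have "s l = (1 + b l * real n * s (Suc l)) / (\<delta> + (real n + 1) * b l)"
        unfolding s_def n(1) n_def[symmetric] by (simp add: t_def n(2))
      then have "s l * (\<delta> + (real n + 1) * b l) = 1 + b l * real n * s (Suc l)"
        using pos by simp
      then show ?thesis
        unfolding n(3) by (simp add: algebra_simps)
    qed
    have s_K: "\<delta> * s K = 1"
      using \<delta>_pos by (simp add: s_def t_def)
    define f where "f x = d x * s (c x)" for x
    have G_f: "G f x = (if A x then - d x else - \<delta> * f x)" if x: "x \<subseteq> N" for x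
    proof -
      define y where "y = real K - real (c x)"
      \<comment> \<open>Every insertion lowers d by \<open>1 / K\<close> through the fraction, and
        inserting j itself also raises the indicator. As
        \<open>y / K = d x + of_bool (j \<notin> x)\<close>, the sum is a multiple of
        \<open>d x\<close>.\<close>
      have "(\<Sum>v\<in>V - x. d (insert v x)) = (\<Sum>v\<in>V - x. (d x - 1 / real K) + of_bool (v = j \<and> j \<notin> x))"
        by (intro sum.cong) (auto simp: d_def c_insert add_divide_distrib)
      also have "\<dots> = y * (d x - 1 / real K) + of_bool (j \<notin> x)"
      proof -
        have "(V - x) \<inter> {v. v = j \<and> j \<notin> x} = (if j \<in> x then {} else {j})"
          using j by auto
        then have "(\<Sum>v\<in>V - x. of_bool (v = j \<and> j \<notin> x)) = (of_bool (j \<notin> x) :: real)"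
          using fin_V by (simp add: of_bool_def sum.If_cases)
        then show ?thesis
          by (simp add: sum.distrib card_stale y_def)
      qed
      also have "\<dots> = (y - 1) * d x"
        using K_pos by (simp add: d_def y_def field_simps)
      finally have d_sum: "(\<Sum>v\<in>V - x. d (insert v x)) = (y - 1) * d x" .
      have "(\<Sum>v\<in>V - x. f (insert v x) - f x)
          = (\<Sum>v\<in>V - x. d (insert v x) * s (Suc (c x)) - f x)"
        by (intro sum.cong) (auto simp: f_def c_insert)
      also have "\<dots> = (y - 1) * d x * s (Suc (c x)) - y * f x"
        by (simp add: sum_subtractf card_stale y_def d_sum flip: sum_distrib_right)
      finally have sum: "(\<Sum>v\<in>V - x. f (insert v x) - f x)
          = d x * ((y - 1) * s (Suc (c x)) - y * s (c x))"
        by (simp add: f_def algebra_simps)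
      have other: "f (insert v x) = f x" if "v \<in> N - V" for v
        using that j by (auto simp: f_def d_def c_insert_other)
      have f0: "f {} = 0"
        by (simp add: f_def d_def c_empty)
      show ?thesis
      proof (cases "c x < K")
        case True
        have "- \<delta> * f x + b (c x) * (d x * ((y - 1) * s (Suc (c x)) - y * s (c x)))
            = - d x * (\<delta> * s (c x) + b (c x) * (y * s (c x) - (y - 1) * s (Suc (c x))))"
          by (simp add: f_def algebra_simps)
        also have "\<dots> = - d x"
          using s_eq[OF True] by (simp add: y_def)
        finally show ?thesis
          using G_V[OF x other] f0 sum by auto
      next
        case False
        then have "c x = K"
          using c_le[of x] by simp
        then have "V \<subseteq> x"
          using card_subset_eq[of V "V \<inter> x"] fin_V by (auto simp: c_def K_def)
        then have "d x = 0"
          using j \<open>c x = K\<close> K_pos by (auto simp: d_def)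
        then have "f x = 0"
          by (simp add: f_def)
        then show ?thesis
          using G_V[OF x other] f0 sum \<open>d x = 0\<close> by simp
      qed
    qed
    \<comment> \<open>On inactive states \<open>G f = - \<delta> * f\<close>, so the error
      \<open>d + G f\<close> is \<open>d * (1 - \<delta> * s)\<close>; C bounds the second factor
      for every count.\<close>
    define C where "C = (\<Sum>l\<le>K. \<bar>1 - \<delta> * s l\<bar>)"
    have "L (\<lambda>x. - 1 * G f x) 0"
      using L_cmult[OF L_G, of "-1"] by simp
    then show ?thesis
    proof (rule L_perturb[OF _ e_null, where C = C])
      fix x assume x: "x \<subseteq> N"
      show "\<bar>d x - - 1 * G f x\<bar> \<le> C * e x"
      proof (cases "A x \<or> V \<inter> x = {}")
        case True
        then show ?thesis
          using j c_0[of x] G_f[OF x] by (auto simp: e_def d_def f_def)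
      next
        case False
        have "\<bar>d x - - 1 * G f x\<bar> = \<bar>d x\<bar> * \<bar>1 - \<delta> * s (c x)\<bar>"
          using False G_f[OF x] by (simp add: f_def algebra_simps flip: abs_mult)
        also have "\<dots> \<le> 1 * C"
        proof (rule mult_mono)
          have "0 \<le> real (c x) / real K" "real (c x) / real K \<le> 1"
            using c_le[of x] K_pos by auto
          then show "\<bar>d x\<bar> \<le> 1"
            unfolding d_def by (cases "j \<in> x") auto
          show "\<bar>1 - \<delta> * s (c x)\<bar> \<le> C"
            unfolding C_def using c_le[of x]
            by (intro member_le_sum[of "c x" "{..K}" "\<lambda>l. \<bar>1 - \<delta> * s l\<bar>"]) auto
        qed auto
        finally show ?thesis
          using False by (simp add: e_def)
      qed
    qed
  qed

  have "L (\<lambda>x. d x + 1 / real K * real (c x))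
      (0 + 1 / real K * (p * (\<Sum>r=1..K. \<Prod>i<r. a i / (a i + \<delta>))))"
    by (intro L_add L_cmult d_null count_avg)
  moreover have "(\<Prod>i<r. a i / (a i + \<delta>)) = (\<Prod>i=1..r.
      (real K - real i + 1) * b (i - 1) / ((real K - real i + 1) * b (i - 1) + \<delta>))" for r
    by (rule prod.reindex_bij_witness[of _ "\<lambda>i. i - 1" Suc])
       (auto simp: a_def of_nat_diff)
  ultimately show ?thesis
    by (simp add: d_def mult_ac)
qed

end

section \<open>The clustered network\<close>

text \<open>The numbers K, ..., K - s are K followed by K - 1, ..., K - s. The K in front later
  cancels the \<open>1 / k\<close> of the fresh fraction.\<close>

lemma shifted_product:
  "(\<Prod>i=1..Suc s. (K - real i + 1) * \<beta> i) = K * (\<Prod>i=1..s. (K - real i) * \<beta> i) * \<beta> (Suc s)"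
  by (induction s) (simp_all add: algebra_simps)

locale clustered_network =
  fixes src :: source_scheme and cl :: cluster_scheme and m k :: nat
    and lam_e lam_s lam_c lam_g :: real and M :: "'a measure" and X :: "real \<Rightarrow> 'a \<Rightarrow> node set"
  assumes m_pos: "m \<ge> 1" and k_pos: "k \<ge> 1"
    and lam_e_pos: "lam_e > 0" and lam_s_pos: "lam_s > 0" and lam_c_pos: "lam_c > 0"
    and lam_g_nonneg: "lam_g \<ge> 0"
    and gossip: "clustered_gossip src cl m k lam_e lam_s lam_c lam_g M X"
begin

abbreviation N :: "node set" where "N \<equiv> nodes m k"

abbreviation \<phi> :: "node set \<Rightarrow> node \<Rightarrow> real" where
  "\<phi> \<equiv> fresh_rate src cl m k lam_s lam_c lam_g"

abbreviation Lim_avg :: "(node set \<Rightarrow> real) \<Rightarrow> real \<Rightarrow> bool" where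
  "Lim_avg f l \<equiv> (time_avg M X f \<longlongrightarrow> l) at_top"

sublocale ctmc_process M "Pow N" "jump_rate src cl m k lam_e lam_s lam_c lam_g" "{}" X
  using gossip by unfold_locales (simp add: clustered_gossip_def)

section \<open>The network as a growing set of fresh nodes with resets\<close>

lemma finite_nodes: "finite N"
  unfolding nodes_def by simp

text \<open>A jump is a reset or the addition of one stale node. After exchanging the sums, each v
  selects its own target and the sum over all subsets collapses.\<close>

lemma gen_jump_rate:
  assumes "x \<subseteq> N"
  shows "gen f x = lam_e * (f {} - f x) + (\<Sum>v\<in>N - x. \<phi> x v * (f (insert v x) - f x))"
proof -
  have fin: "finite (Pow N)"
    using finite_nodes by simp
  have "gen f x = (\<Sum>y\<in>Pow N. (if y = {} then lam_e * (f y - f x) else 0)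
      + (\<Sum>v\<in>N - x. if y = insert v x then \<phi> x v * (f y - f x) else 0))"
    unfolding gen_def jump_rate_def
    by (simp add: distrib_right sum_distrib_right if_distrib[where f = "\<lambda>u. u * d" for d]
        cong: if_cong)
  also have "\<dots> = (\<Sum>y\<in>Pow N. if y = {} then lam_e * (f y - f x) else 0)
      + (\<Sum>v\<in>N - x. \<Sum>y\<in>Pow N. if y = insert v x then \<phi> x v * (f y - f x) else 0)"
    unfolding sum.distrib by (intro arg_cong2[where f = "(+)"] refl sum.swap)
  also have "(\<Sum>y\<in>Pow N. if y = {} then lam_e * (f y - f x) else 0) = lam_e * (f {} - f x)"
    using fin by (subst sum.delta) auto
  also have "(\<Sum>v\<in>N - x. \<Sum>y\<in>Pow N. if y = insert v x then \<phi> x v * (f y - f x) else 0)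
      = (\<Sum>v\<in>N - x. \<phi> x v * (f (insert v x) - f x))"
  proof (rule sum.cong)
    fix v assume "v \<in> N - x"
    then have "insert v x \<in> Pow N"
      using assms by auto
    then show "(\<Sum>y\<in>Pow N. if y = insert v x then \<phi> x v * (f y - f x) else 0)
        = \<phi> x v * (f (insert v x) - f x)"
      using fin by (subst sum.delta) auto
  qed simp
  finally show ?thesis .
qed

sublocale reset_growth N \<phi> lam_e Lim_avg
proof
  show "finite N" by (rule finite_nodes)
  show "lam_e > 0" by (rule lam_e_pos)
  show "Lim_avg (\<lambda>_. 1) 1"
    by (rule tendsto_eventually, rule eventually_mono[OF eventually_gt_at_top[of 0]])
       (rule time_avg_const)
  show "Lim_avg (\<lambda>x. a * f x + b * g x) (a * l + b * l')"
    if "Lim_avg f l" "Lim_avg g l'" for f l g l' a b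
    unfolding time_avg_linear[abs_def] using that by (intro tendsto_intros)
  show "Lim_avg f 0" if le: "\<And>x. x \<subseteq> N \<Longrightarrow> \<bar>f x\<bar> \<le> g x" and g: "Lim_avg g 0" for f g
  proof (rule Lim_null_comparison[OF _ g])
    show "eventually (\<lambda>T. norm (time_avg M X f T) \<le> time_avg M X g T) at_top"
      using eventually_ge_at_top[of 0]
    proof eventually_elim
      case (elim T)
      have "time_avg M X f T \<le> time_avg M X g T"
        using le elim by (intro time_avg_mono) (auto dest: abs_le_D1)
      \<comment> \<open>Negation is written as a linear combination to match
        \<open>time_avg_linear\<close>.\<close>
      moreover have "time_avg M X (\<lambda>z. - 1 * f z + 0 * f z) T \<le> time_avg M X g T"
        using le elim by (intro time_avg_mono) (auto dest: abs_le_D2)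
      then have "- time_avg M X f T \<le> time_avg M X g T"
        by (simp only: time_avg_linear)
      ultimately show ?case
        by simp
    qed
  qed
  show "Lim_avg (\<lambda>x. lam_e * (f {} - f x)
      + (\<Sum>v\<in>N - x. \<phi> x v * (f (insert v x) - f x))) 0" for f
  proof (rule Lim_transform_eventually[OF time_avg_gen[of f]])
    show "eventually (\<lambda>T. time_avg M X (gen f) T = time_avg M X (\<lambda>x. lam_e * (f {} - f x)
        + (\<Sum>v\<in>N - x. \<phi> x v * (f (insert v x) - f x))) T) at_top"
      using eventually_ge_at_top[of 0]
      by eventually_elim (auto intro!: time_avg_cong gen_jump_rate)
  qed
qed

section \<open>Rates, unreachable states and the averages of single nodes\<close>

lemma card_CH: "card (CH ` {..<m} \<inter> x) = card {c. c < m \<and> CH c \<in> x}"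
proof -
  have "CH ` {..<m} \<inter> x = CH ` {c. c < m \<and> CH c \<in> x}"
    by auto
  then show ?thesis
    by (simp add: card_image inj_on_def)
qed

lemma card_EN: "card (EN c ` {..<k} \<inter> x) = card {j. j < k \<and> EN c j \<in> x}"
proof -
  have "EN c ` {..<k} \<inter> x = EN c ` {j. j < k \<and> EN c j \<in> x}"
    by auto
  then show ?thesis
    by (simp add: card_image inj_on_def)
qed

text \<open>At l = m the \<open>DC_RC\<close> rate is a division by zero, hence 0. The same
  convention covers \<open>en_rate\<close> below at l = k for \<open>FC_allRC\<close> and at k = 1
  for \<open>FC_noRC\<close>.\<close>

lemma ch_rate_nonneg: "l \<le> m \<Longrightarrow> ch_rate src m lam_s l \<ge> 0"
  using lam_s_pos by (cases src) auto

lemma en_rate_nonneg: "l \<le> k \<Longrightarrow> en_rate cl k lam_c lam_g l \<ge> 0"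
  using k_pos lam_c_pos lam_g_nonneg by (cases cl) auto

lemma fresh_rate_nonneg: "\<phi> x v \<ge> 0"
proof (cases v)
  case (CH c)
  have "card {c'. c' < m \<and> CH c' \<in> x} \<le> card {..<m}"
    by (rule card_mono) auto
  then show ?thesis
    using CH ch_rate_nonneg by simp
next
  case (EN c j)
  have "card {j'. j' < k \<and> EN c j' \<in> x} \<le> card {..<k}"
    by (rule card_mono) auto
  then show ?thesis
    using EN en_rate_nonneg by simp
qed

text \<open>No jump leads into these states: an end-node under a stale clusterhead has rate 0, and
  no other addition can make the event true. Hence \<open>G e \<le> - lam_e * e\<close>, and the
  average of \<open>G e\<close> is 0.\<close>

lemma stale_cluster_null:
  "Lim_avg (\<lambda>x. of_bool (CH c \<notin> x \<and> EN c ` {..<k} \<inter> x \<noteq> {})) 0"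
proof -
  define e :: "node set \<Rightarrow> real" where
    "e x = of_bool (CH c \<notin> x \<and> EN c ` {..<k} \<inter> x \<noteq> {})" for x
  have null: "Lim_avg (\<lambda>x. (- 1 / lam_e) * G e x) 0"
    using L_cmult[OF L_G, of "- 1 / lam_e"] by simp
  have "\<bar>e x\<bar> \<le> (- 1 / lam_e) * G e x" if "x \<subseteq> N" for x
  proof -
    have "(\<Sum>v\<in>N - x. \<phi> x v * (e (insert v x) - e x)) \<le> 0"
    proof (rule sum_nonpos)
      fix v assume "v \<in> N - x"
      show "\<phi> x v * (e (insert v x) - e x) \<le> 0"
      proof (cases "CH c \<notin> x \<and> v \<in> EN c ` {..<k}")
        case True
        then show ?thesis by auto
      next
        case False
        then have "e (insert v x) \<le> e x"
          by (auto simp: e_def)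
        then show ?thesis
          using fresh_rate_nonneg by (simp add: mult_nonneg_nonpos)
      qed
    qed
    then have "G e x \<le> - lam_e * e x"
      unfolding G_def by (simp add: e_def)
    then show ?thesis
      using lam_e_pos by (simp add: e_def field_simps)
  qed
  then have "Lim_avg e 0"
    by (rule L_squeeze[OF _ null])
  then show ?thesis
    by (simp add: e_def[abs_def])
qed

text \<open>The growing group is the set of end-nodes of cluster c, active while \<open>CH c\<close>
  is fresh. The averages converge, so the \<open>Limsup\<close> is their limit.\<close>

lemma end_node_average:
  assumes c: "c < m" and j: "j < k" and p: "Lim_avg (\<lambda>x. of_bool (CH c \<in> x)) p"
  shows "avg_freshness M X (EN c j) = ereal (p * (1 / real k * (\<Sum>r=1..k. \<Prod>i=1..r.
    (real k - real i + 1) * en_rate cl k lam_c lam_g (i - 1) /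
    ((real k - real i + 1) * en_rate cl k lam_c lam_g (i - 1) + lam_e))))"
proof -
  have card: "card (EN c ` {..<k}) = k"
    by (simp add: card_image inj_on_def)
  have "Lim_avg (\<lambda>x. of_bool (EN c j \<in> x)) (p * (1 / real (card (EN c ` {..<k})) *
    (\<Sum>r=1..card (EN c ` {..<k}). \<Prod>i=1..r.
    (real (card (EN c ` {..<k})) - real i + 1) * en_rate cl k lam_c lam_g (i - 1) /
    ((real (card (EN c ` {..<k})) - real i + 1) * en_rate cl k lam_c lam_g (i - 1) + lam_e))))"
  proof (rule growth_average[OF _ _ _ _ stale_cluster_null p])
    show "EN c ` {..<k} \<subseteq> N"
      using c by (auto simp: nodes_def)
    show "EN c j \<in> EN c ` {..<k}"
      using j by simp
    show "\<phi> x v = (if CH c \<in> x then en_rate cl k lam_c lam_g (card (EN c ` {..<k} \<inter> x)) else 0)"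
      if "v \<in> EN c ` {..<k} - x" for x v
      using that by (auto simp: card_EN)
    show "en_rate cl k lam_c lam_g l \<ge> 0" if "l < card (EN c ` {..<k})" for l
      using that by (intro en_rate_nonneg) (simp add: card)
  qed
  note lim = this[unfolded card]
  have "avg_freshness M X (EN c j) = Limsup at_top (\<lambda>T. ereal (time_avg M X (\<lambda>x. of_bool (EN c j \<in> x)) T))"
    unfolding avg_freshness_def time_avg_def of_bool_def ..
  then show ?thesis
    using lim_imp_Limsup[OF _ lim[folded lim_ereal]] by simp
qed

text \<open>Under \<open>DC_noRC\<close> a clusterhead is a two-state chain of its own, so its
  indicator is already a sufficient test function and gives the closed form. Under
  \<open>DC_RC\<close> the rates depend on the count; the clusterheads then form one group that is
  always active.\<close>

lemma clusterhead_average: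
  assumes "c < m"
  shows "Lim_avg (\<lambda>x. of_bool (CH c \<in> x)) (case src of
      DC_noRC \<Rightarrow> lam_s / (lam_s + real m * lam_e)
    | DC_RC \<Rightarrow> 1 / real m * (lam_s / lam_e) * (1 - (lam_s / (lam_s + lam_e)) ^ m))"
proof (cases src)
  case DC_noRC
  define f :: "node set \<Rightarrow> real" where "f x = of_bool (CH c \<in> x)" for x
  define \<mu> where "\<mu> = lam_s / real m"
  have pos: "lam_e + \<mu> > 0"
    using lam_e_pos lam_s_pos by (simp add: \<mu>_def add_pos_nonneg)
  have G_f: "G f x = - lam_e * f x + \<mu> * (1 - f x)" if "x \<subseteq> N" for x
  proof -
    have "(\<Sum>v\<in>N - x. \<phi> x v * (f (insert v x) - f x))
        = (\<Sum>v\<in>{CH c} - x. \<phi> x v * (f (insert v x) - f x))"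
      using assms finite_nodes by (intro sum.mono_neutral_right) (auto simp: f_def nodes_def)
    also have "\<dots> = \<mu> * (1 - f x)"
      using DC_noRC by (cases "CH c \<in> x") (auto simp: f_def \<mu>_def insert_Diff_if)
    finally show ?thesis
      unfolding G_def by (simp add: f_def)
  qed
  have "Lim_avg (\<lambda>x. 1 / (lam_e + \<mu>) * (\<mu> * 1 - G f x)) (1 / (lam_e + \<mu>) * (\<mu> * 1 - 0))"
    by (intro L_cmult L_diff L_one L_G)
  then have "Lim_avg f (1 / (lam_e + \<mu>) * (\<mu> * 1 - 0))"
    by (rule L_cong) (use pos in \<open>simp add: G_f field_simps\<close>)
  moreover have "1 / (lam_e + \<mu>) * (\<mu> * 1 - 0) = lam_s / (lam_s + real m * lam_e)"
    using m_pos pos lam_s_pos lam_e_pos by (simp add: \<mu>_def field_simps)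
  ultimately show ?thesis
    using DC_noRC by (simp add: f_def[abs_def])
next
  case DC_RC
  define \<rho> where "\<rho> = lam_s / (lam_s + lam_e)"
  have card: "card (CH ` {..<m}) = m"
    by (simp add: card_image inj_on_def)
  have "Lim_avg (\<lambda>x. of_bool (CH c \<in> x)) (1 * (1 / real (card (CH ` {..<m})) *
    (\<Sum>r=1..card (CH ` {..<m}). \<Prod>i=1..r.
    (real (card (CH ` {..<m})) - real i + 1) * ch_rate src m lam_s (i - 1) /
    ((real (card (CH ` {..<m})) - real i + 1) * ch_rate src m lam_s (i - 1) + lam_e))))"
  proof (rule growth_average[where A = "\<lambda>_. True"])
    show "CH ` {..<m} \<subseteq> N"
      by (auto simp: nodes_def)
    show "CH c \<in> CH ` {..<m}"
      using assms by simp
    show "\<phi> x v = (if True then ch_rate src m lam_s (card (CH ` {..<m} \<inter> x)) else 0)"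
      if "v \<in> CH ` {..<m} - x" for x v
      using that by (auto simp: card_CH)
    show "ch_rate src m lam_s l \<ge> 0" if "l < card (CH ` {..<m})" for l
      using that by (intro ch_rate_nonneg) (simp add: card)
  qed (simp_all add: L_zero L_one)
  note lim = this[unfolded card]
  have "(\<Prod>i=1..r. (real m - real i + 1) * ch_rate src m lam_s (i - 1) /
      ((real m - real i + 1) * ch_rate src m lam_s (i - 1) + lam_e)) = \<rho> ^ r" if "r \<le> m" for r
  proof -
    \<comment> \<open>The stale clusterheads share \<open>lam_s\<close> equally, so the total rate
      is constant and the product becomes a power.\<close>
    have "(real m - real i + 1) * ch_rate src m lam_s (i - 1) = lam_s" if "i \<in> {1..r}" for i
    proof -
      have eq: "real m - real (i - 1) = real m - real i + 1" and "real m - real i + 1 \<noteq> 0"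
        using that \<open>r \<le> m\<close> by (simp_all add: of_nat_diff)
      then show ?thesis
        unfolding DC_RC ch_rate.simps eq by simp
    qed
    then have "(\<Prod>i=1..r. (real m - real i + 1) * ch_rate src m lam_s (i - 1) /
      ((real m - real i + 1) * ch_rate src m lam_s (i - 1) + lam_e)) = (\<Prod>i=1..r. \<rho>)"
      by (intro prod.cong) (simp_all add: \<rho>_def)
    then show ?thesis
      by simp
  qed
  then have "Lim_avg (\<lambda>x. of_bool (CH c \<in> x)) (1 / real m * (\<Sum>r=1..m. \<rho> ^ r))"
    using lim by simp
  \<comment> \<open>Geometric sum, with
    \<open>\<rho> / (1 - \<rho>) = lam_s / lam_e\<close>.\<close>
  moreover have "(\<Sum>r=1..n. \<rho> ^ r) = lam_s / lam_e * (1 - \<rho> ^ n)" for n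
  proof (induction n)
    case (Suc n)
    have "\<rho> * (lam_s + lam_e) = lam_s"
      using lam_s_pos lam_e_pos by (simp add: \<rho>_def)
    then have "lam_e * \<rho> = lam_s - lam_s * \<rho>"
      by (simp add: algebra_simps)
    then have "\<rho> = lam_s / lam_e * (1 - \<rho>)"
      using lam_e_pos by (simp add: field_simps)
    then have "\<rho> ^ Suc n = lam_s / lam_e * (1 - \<rho>) * \<rho> ^ n"
      by simp
    then have "(\<Sum>r=1..Suc n. \<rho> ^ r)
        = lam_s / lam_e * (1 - \<rho> ^ n) + lam_s / lam_e * (1 - \<rho>) * \<rho> ^ n"
      using Suc.IH by (simp del: power_Suc)
    also have "\<dots> = lam_s / lam_e * (1 - \<rho> ^ Suc n)"
    proof -
      have "a * (1 - \<rho> ^ n) + a * (1 - \<rho>) * \<rho> ^ n = a * (1 - \<rho> ^ Suc n)" for a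
        by (simp add: algebra_simps)
      then show ?thesis .
    qed
    finally show ?case .
  qed simp
  ultimately show ?thesis
    using DC_RC by (simp add: \<rho>_def mult_ac)
qed

lemma end_node_average_noRC:
  assumes "cl = FC_noRC" "c < m" "j < k" "Lim_avg (\<lambda>x. of_bool (CH c \<in> x)) p"
  shows "avg_freshness M X (EN c j) = ereal (p * (\<Sum>r=1..k.
             (\<Prod>i=1..r-1.
                ((real k - real i) * (lam_c / real k + (real i - 1) * (lam_g / (real k - 1)))) /
                ((real k - real i + 1) * (lam_c / real k + (real i - 1) * (lam_g / (real k - 1))) + lam_e)) *
             ((lam_c / real k + (real r - 1) * (lam_g / (real k - 1))) /
              ((real k - real r + 1) * (lam_c / real k + (real r - 1) * (lam_g / (real k - 1))) + lam_e))))"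
proof -
  define b where "b i = lam_c / real k + (real i - 1) * (lam_g / (real k - 1))" for i :: nat
  \<comment> \<open>A factor of the product without its stale count, so that
    \<open>shifted_product\<close> can shift the counts alone.\<close>
  define \<beta> where "\<beta> i = b i / ((real k - real i + 1) * b i + lam_e)" for i
  have "1 / real k * (\<Sum>r=1..k. \<Prod>i=1..r.
      (real k - real i + 1) * en_rate cl k lam_c lam_g (i - 1) /
      ((real k - real i + 1) * en_rate cl k lam_c lam_g (i - 1) + lam_e))
    = (\<Sum>r=1..k. 1 / real k * (\<Prod>i=1..r. (real k - real i + 1) * \<beta> i))"
    unfolding sum_distrib_left using assms(1)
    by (intro sum.cong arg_cong2[where f = "(*)"] prod.cong) (auto simp: \<beta>_def b_def of_nat_diff)
  also have "\<dots> = (\<Sum>r=1..k. (\<Prod>i=1..r-1. (real k - real i) * \<beta> i) * \<beta> r)"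
  proof (rule sum.cong)
    fix r assume "r \<in> {1..k}"
    then obtain s where "r = Suc s"
      by (cases r) auto
    then show "1 / real k * (\<Prod>i=1..r. (real k - real i + 1) * \<beta> i)
        = (\<Prod>i=1..r-1. (real k - real i) * \<beta> i) * \<beta> r"
      using k_pos by (simp only: shifted_product) simp
  qed simp
  finally show ?thesis
    unfolding end_node_average[OF assms(2-4)] by (simp add: \<beta>_def b_def)
qed

text \<open>Splitting the rates among the stale nodes makes the stale count cancel: with l fresh
  end-nodes the total rate is \<open>lam_c + l * lam_g\<close>.\<close>

lemma end_node_average_allRC:
  assumes "cl = FC_allRC" "c < m" "j < k" "Lim_avg (\<lambda>x. of_bool (CH c \<in> x)) p"
  shows "avg_freshness M X (EN c j) = ereal (p * (1 / real k *
           (\<Sum>r=1..k. \<Prod>i=1..r.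
              (lam_c + (real i - 1) * lam_g) / (lam_c + (real i - 1) * lam_g + lam_e))))"
proof -
  have "(real k - real i + 1) * en_rate cl k lam_c lam_g (i - 1) = lam_c + (real i - 1) * lam_g"
    if "1 \<le> i" "i \<le> k" for i
  proof -
    have eq: "real k - real (i - 1) = real k - real i + 1" and "real k - real i + 1 \<noteq> 0"
      using that by (simp_all add: of_nat_diff)
    then show ?thesis
      unfolding assms(1) en_rate.simps eq using that by (simp add: of_nat_diff)
  qed
  then show ?thesis
    unfolding end_node_average[OF assms(2-4)]
    by (intro arg_cong[where f = ereal] arg_cong2[where f = "(*)"] refl sum.cong prod.cong) auto
qed

end

theorem mainTheorem6:
  fixes m k :: nat and lam_e lam_s lam_c lam_g :: real
    and M :: "'a measure" and X :: "real \<Rightarrow> 'a \<Rightarrow> node set"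
  assumes "m \<ge> 1" and "k \<ge> 1"
    and "lam_e > 0" and "lam_s > 0" and "lam_c > 0" and "lam_g \<ge> 0"
  shows
    "(k \<ge> 2 \<longrightarrow> clustered_gossip DC_noRC FC_noRC m k lam_e lam_s lam_c lam_g M X \<longrightarrow>
       (\<forall>c<m. \<forall>j<k. avg_freshness M X (EN c j) = ereal (
          lam_s / (lam_s + real m * lam_e) *
          (\<Sum>r=1..k.
             (\<Prod>i=1..r-1.
                ((real k - real i) * (lam_c / real k + (real i - 1) * (lam_g / (real k - 1)))) /
                ((real k - real i + 1) * (lam_c / real k + (real i - 1) * (lam_g / (real k - 1))) + lam_e)) *
             ((lam_c / real k + (real r - 1) * (lam_g / (real k - 1))) /
              ((real k - real r + 1) * (lam_c / real k + (real r - 1) * (lam_g / (real k - 1))) + lam_e))))))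
     \<and>
     (k \<ge> 2 \<longrightarrow> clustered_gossip DC_RC FC_noRC m k lam_e lam_s lam_c lam_g M X \<longrightarrow>
       (\<forall>c<m. \<forall>j<k. avg_freshness M X (EN c j) = ereal (
          1 / real m * (lam_s / lam_e) * (1 - (lam_s / (lam_s + lam_e)) ^ m) *
          (\<Sum>r=1..k.
             (\<Prod>i=1..r-1.
                ((real k - real i) * (lam_c / real k + (real i - 1) * (lam_g / (real k - 1)))) /
                ((real k - real i + 1) * (lam_c / real k + (real i - 1) * (lam_g / (real k - 1))) + lam_e)) *
             ((lam_c / real k + (real r - 1) * (lam_g / (real k - 1))) /
              ((real k - real r + 1) * (lam_c / real k + (real r - 1) * (lam_g / (real k - 1))) + lam_e))))))
     \<and>
     (clustered_gossip DC_RC FC_allRC m k lam_e lam_s lam_c lam_g M X \<longrightarrow>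
       (\<forall>c<m. \<forall>j<k. avg_freshness M X (EN c j) = ereal (
          1 / real m * (lam_s / lam_e) * (1 - (lam_s / (lam_s + lam_e)) ^ m) *
          (1 / real k *
           (\<Sum>r=1..k. \<Prod>i=1..r.
              (lam_c + (real i - 1) * lam_g) / (lam_c + (real i - 1) * lam_g + lam_e))))))"
proof -
  have network: "clustered_network src cl m k lam_e lam_s lam_c lam_g M X"
    if "clustered_gossip src cl m k lam_e lam_s lam_c lam_g M X" for src cl
    using assms that by unfold_locales
  show ?thesis
  proof (intro conjI impI allI)
    fix c j
    assume g: "clustered_gossip DC_noRC FC_noRC m k lam_e lam_s lam_c lam_g M X"
      and c: "c < m" and j: "j < k"
    interpret clustered_network DC_noRC FC_noRC m k lam_e lam_s lam_c lam_g M X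
      by (rule network[OF g])
    note avg = end_node_average_noRC[OF refl c j clusterhead_average[OF c]]
    show "avg_freshness M X (EN c j) = ereal (
          lam_s / (lam_s + real m * lam_e) *
          (\<Sum>r=1..k.
             (\<Prod>i=1..r-1.
                ((real k - real i) * (lam_c / real k + (real i - 1) * (lam_g / (real k - 1)))) /
                ((real k - real i + 1) * (lam_c / real k + (real i - 1) * (lam_g / (real k - 1))) + lam_e)) *
             ((lam_c / real k + (real r - 1) * (lam_g / (real k - 1))) /
              ((real k - real r + 1) * (lam_c / real k + (real r - 1) * (lam_g / (real k - 1))) + lam_e))))"
      using avg unfolding source_scheme.case .
  next
    fix c j
    assume g: "clustered_gossip DC_RC FC_noRC m k lam_e lam_s lam_c lam_g M X"
      and c: "c < m" and j: "j < k"
    interpret clustered_network DC_RC FC_noRC m k lam_e lam_s lam_c lam_g M X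
      by (rule network[OF g])
    note avg = end_node_average_noRC[OF refl c j clusterhead_average[OF c]]
    show "avg_freshness M X (EN c j) = ereal (
          1 / real m * (lam_s / lam_e) * (1 - (lam_s / (lam_s + lam_e)) ^ m) *
          (\<Sum>r=1..k.
             (\<Prod>i=1..r-1.
                ((real k - real i) * (lam_c / real k + (real i - 1) * (lam_g / (real k - 1)))) /
                ((real k - real i + 1) * (lam_c / real k + (real i - 1) * (lam_g / (real k - 1))) + lam_e)) *
             ((lam_c / real k + (real r - 1) * (lam_g / (real k - 1))) /
              ((real k - real r + 1) * (lam_c / real k + (real r - 1) * (lam_g / (real k - 1))) + lam_e))))"
      using avg unfolding source_scheme.case .
  next
    fix c j
    assume g: "clustered_gossip DC_RC FC_allRC m k lam_e lam_s lam_c lam_g M X"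
      and c: "c < m" and j: "j < k"
    interpret clustered_network DC_RC FC_allRC m k lam_e lam_s lam_c lam_g M X
      by (rule network[OF g])
    note avg = end_node_average_allRC[OF refl c j clusterhead_average[OF c]]
    show "avg_freshness M X (EN c j) = ereal (
          1 / real m * (lam_s / lam_e) * (1 - (lam_s / (lam_s + lam_e)) ^ m) *
          (1 / real k *
           (\<Sum>r=1..k. \<Prod>i=1..r.
              (lam_c + (real i - 1) * lam_g) / (lam_c + (real i - 1) * lam_g + lam_e))))"
      using avg unfolding source_scheme.case .
  qed
qed

end
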